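(* Let $(\rho_*,m_* )\in\mathbb{R}^2$ with $\rho_*>0$ and $p'(\rho_* )>m_*^2/\rho_*^2$, and let $$\widehat A(\xi)=\begin{pmatrix}0&\alpha(\xi)^{1/2}\\ \alpha(\xi)^{1/2}&2m_*/\rho_*\end{pmatrix},\quad B_*=\begin{pmatrix}0&0\\0&\mu\end{pmatrix},\quad \alpha(\xi)=p'(\rho_* )-\frac{m_*^2}{\rho_*^2}+\tfrac12k^2\xi^2,\qquad \xi\in\mathbb{R}.$$ There exists a smooth compensating matrix symbol $\widehat K\in C^\infty(\mathbb{R};\mathbb{R}^{2\times2})$, $\widehat K=\widehat K(\xi)$, for the triplet $(I,\widehat A(\xi),B_* )$. In other words, $\widehat K$ is skew-symmetric and $$[\widehat K(\xi)\widehat A(\xi)]^s+B_*\ge\theta I>0,$$ for some uniform constant $\theta>0$ independent of $\xi\in\mathbb{R}$. In addition, the following estimates hold, $$|\xi\widehat K(\xi)|,\ |\widehat K(\xi)|\le C,$$ for all $\xi\in\mathbb{R}$ and some uniform constant $C>0$.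
   Context: Here $p(\rho)=\rho^\gamma$ with $\gamma>1$, and $\mu>0$, $k>0$ are constants. For a real square matrix $M$, $[M]^s:=\tfrac12(M+M^\top)$ denotes its symmetric part, $|M|$ its operator (Euclidean) norm, and inequalities between symmetric matrices are in the sense of quadratic forms. *)

theory Defs
  imports "HOL-Analysis.Analysis"
begin

text \<open>A matrix of type \<open>real ^ 'n ^ 'n\<close> is indexed row first. The canonical norm of this type is
  the Frobenius norm, so the operator norm is written with \<open>onorm\<close>.\<close>

definition op_norm :: "real ^ 'n ^ 'n \<Rightarrow> real" where
  "op_norm M = onorm ((*v) M)"

definition sym_part :: "real ^ 'n ^ 'n \<Rightarrow> real ^ 'n ^ 'n" where
  "sym_part M = (1 / 2) *\<^sub>R (M + transpose M)"

definition skew_symmetric :: "real ^ 'n ^ 'n \<Rightarrow> bool" where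
  "skew_symmetric M \<longleftrightarrow> transpose M = - M"

definition quad_form_le :: "real ^ 'n ^ 'n \<Rightarrow> real ^ 'n ^ 'n \<Rightarrow> bool" where
  "quad_form_le M N \<longleftrightarrow> (\<forall>v. v \<bullet> (M *v v) \<le> v \<bullet> (N *v v))"

text \<open>Membership in \<open>C\<^sup>\<infinity>\<close> on the whole real line: \<open>D n\<close> is the \<open>n\<close>-th derivative.\<close>

definition smooth :: "(real \<Rightarrow> 'a::real_normed_vector) \<Rightarrow> bool" where
  "smooth f \<longleftrightarrow>
     (\<exists>D. D 0 = f \<and> (\<forall>n x. (D n has_vector_derivative D (Suc n) x) (at x)))"

text \<open>The coercivity constant \<open>\<theta>\<close> is uniform in the frequency \<open>\<xi>\<close>.\<close>

definition compensating_matrix_symbol ::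
  "(real \<Rightarrow> real ^ 'n ^ 'n) \<Rightarrow> (real \<Rightarrow> real ^ 'n ^ 'n) \<Rightarrow> (real \<Rightarrow> real ^ 'n ^ 'n) \<Rightarrow>
   (real \<Rightarrow> real ^ 'n ^ 'n) \<Rightarrow> bool" where
  "compensating_matrix_symbol A0 A B K \<longleftrightarrow>
     smooth K \<and>
     (\<forall>\<xi>. skew_symmetric (K \<xi> ** A0 \<xi>)) \<and>
     (\<exists>\<theta>>0. \<forall>\<xi>. quad_form_le (\<theta> *\<^sub>R mat 1) (sym_part (K \<xi> ** A \<xi>) + B \<xi>))"

definition pressure :: "real \<Rightarrow> real \<Rightarrow> real" where
  "pressure \<gamma> \<rho> = \<rho> powr \<gamma>"

definition alpha :: "real \<Rightarrow> real \<Rightarrow> real \<Rightarrow> real \<Rightarrow> real \<Rightarrow> real" where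
  "alpha \<gamma> k \<rho> m \<xi> = deriv (pressure \<gamma>) \<rho> - m\<^sup>2 / \<rho>\<^sup>2 + (1 / 2) * k\<^sup>2 * \<xi>\<^sup>2"

definition A_hat :: "real \<Rightarrow> real \<Rightarrow> real \<Rightarrow> real \<Rightarrow> real \<Rightarrow> real ^ 2 ^ 2" where
  "A_hat \<gamma> k \<rho> m \<xi> =
     vector [vector [0, sqrt (alpha \<gamma> k \<rho> m \<xi>)],
             vector [sqrt (alpha \<gamma> k \<rho> m \<xi>), 2 * m / \<rho>]]"

definition B_star :: "real \<Rightarrow> real ^ 2 ^ 2" where
  "B_star \<mu> = vector [vector [0, 0], vector [0, \<mu>]]"

end

theory Submission
  imports Defs
begin

text \<open>
  The degenerate direction of \<open>B_star \<mu>\<close> is the first coordinate axis, which the off-diagonal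
  entry \<open>s = sqrt (alpha \<gamma> k \<rho> m \<xi>)\<close> of the symbol couples to the damped second axis. With the
  rotation \<open>J\<close> by a right angle, \<open>J A\<close> has the diagonal \<open>(s, - s)\<close>, so that
  \<open>K = (\<delta> / s) J\<close> produces, uniformly in the frequency, a gain \<open>\<delta>\<close> in the first direction and
  a loss \<open>\<delta>\<close> in the second one, at the price of a cross term \<open>\<delta> c / s\<close> with \<open>c = 2 m / \<rho>\<close>.
  The subsonic condition keeps \<open>s\<close> away from zero, hence the cross term is bounded, and Young's
  inequality absorbs it together with the loss into the damping \<open>\<mu>\<close> as soon as \<open>\<delta>\<close> is small;
  this is \<open>coercivity_by_Young\<close>.

  Since \<open>s\<^sup>2\<close> is a positive quadratic polynomial in \<open>\<xi>\<close>, the factor \<open>1 / s\<close> is smooth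
  (\<open>smooth_poly_powr\<close>) and decays like \<open>1 / \<bar>\<xi>\<bar>\<close>, the latter thanks to \<open>k > 0\<close>. This gives the
  two bounds on the symbol.
\<close>

text \<open>Every derivative of a real power of \<open>q\<close> is a polynomial times a power of \<open>q\<close> with the
  exponent lowered by the order of the derivative; these are the polynomial factors.\<close>

fun powr_deriv_poly :: "real poly \<Rightarrow> real \<Rightarrow> nat \<Rightarrow> real poly" where
  "powr_deriv_poly q r 0 = 1"
| "powr_deriv_poly q r (Suc n) =
     pderiv (powr_deriv_poly q r n) * q +
     smult (r - real n) (pderiv q * powr_deriv_poly q r n)"

lemma smooth_poly_powr:
  fixes q :: "real poly" and r :: real
  assumes pos: "\<And>x. poly q x > 0"
  shows "smooth (\<lambda>x. poly q x powr r)"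
proof -
  define D where
    "D n x = poly (powr_deriv_poly q r n) x * poly q x powr (r - real n)" for n x
  have "(D n has_vector_derivative D (Suc n) x) (at x)" for n x
  proof -
    let ?P = "powr_deriv_poly q r n"
    have *: "poly q x powr (r - real n) = poly q x powr (r - real (Suc n)) * poly q x"
      using pos[of x] by (simp add: powr_diff powr_add)
    have "((\<lambda>x. poly ?P x * poly q x powr (r - real n)) has_real_derivative
        poly (pderiv ?P) x * poly q x powr (r - real n) +
        ((r - real n) * poly q x powr (r - real n - 1) * poly (pderiv q) x) * poly ?P x) (at x)"
      using pos[of x] by (auto intro!: derivative_eq_intros DERIV_fun_powr simp: algebra_simps)
    also have "poly (pderiv ?P) x * poly q x powr (r - real n) +
        ((r - real n) * poly q x powr (r - real n - 1) * poly (pderiv q) x) * poly ?P x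
        = D (Suc n) x"
      unfolding D_def * by (simp add: algebra_simps)
    finally show ?thesis
      by (simp add: D_def[abs_def] has_real_derivative_iff_has_vector_derivative)
  qed
  moreover have "D 0 = (\<lambda>x. poly q x powr r)"
    by (simp add: D_def fun_eq_iff)
  ultimately show ?thesis
    unfolding smooth_def by blast
qed

lemma smooth_scaleR_const:
  fixes f :: "real \<Rightarrow> real" and v :: "'a::real_normed_vector"
  assumes "smooth f"
  shows "smooth (\<lambda>x. f x *\<^sub>R v)"
proof -
  obtain D where D: "D 0 = f" "\<And>n x. (D n has_vector_derivative D (Suc n) x) (at x)"
    using assms unfolding smooth_def by blast
  have "((\<lambda>y. D n y *\<^sub>R v) has_vector_derivative D (Suc n) x *\<^sub>R v) (at x)" for n x
    using has_vector_derivative_scaleR[of "D n" "D (Suc n) x" x UNIV "\<lambda>_. v" 0] D(2)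
    by (simp add: has_real_derivative_iff_has_vector_derivative)
  with D(1) show ?thesis
    unfolding smooth_def by (intro exI[of _ "\<lambda>n y. D n y *\<^sub>R v"]) auto
qed

definition rot90 :: "real ^ 2 ^ 2" where
  "rot90 = vector [vector [0, 1], vector [-1, 0]]"

lemma skew_symmetric_scaleR_rot90: "skew_symmetric (t *\<^sub>R rot90)"
  unfolding skew_symmetric_def rot90_def
  by (simp add: vec_eq_iff forall_2 transpose_def)

lemma norm_rot90_mult: "norm (rot90 *v v) = norm v"
  by (simp add: norm_vec_def L2_set_def sum_2 rot90_def matrix_vector_mult_def add.commute)

text \<open>A rotation is an isometry, so the scalar factor alone governs the size of the symbol.\<close>

lemma op_norm_scaleR_rot90_le: "op_norm (t *\<^sub>R rot90) \<le> \<bar>t\<bar>"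
  unfolding op_norm_def
  by (rule onorm_bound) (simp_all flip: scaleR_matrix_vector_assoc add: norm_rot90_mult)

lemma quad_form_compensated:
  fixes s c t \<mu> :: real and v :: "real ^ 2"
  shows "v \<bullet> ((sym_part ((t *\<^sub>R rot90) ** vector [vector [0, s], vector [s, c]]) + B_star \<mu>) *v v)
    = t * s * (v $ 1)\<^sup>2 + t * c * (v $ 1) * (v $ 2) + (\<mu> - t * s) * (v $ 2)\<^sup>2"
  by (simp add: sym_part_def rot90_def B_star_def inner_vec_def matrix_vector_mult_def
      matrix_matrix_mult_def transpose_def sum_2 power2_eq_square field_simps)

text \<open>Half of the gain \<open>\<delta>\<close> in \<open>x\<close> pays for the cross term. The choice of \<open>\<delta>\<close> makes the total loss
  \<open>\<delta> + \<delta> c\<^sup>2 / (2 a)\<close> in \<open>y\<close> equal to \<open>\<mu> / 2\<close>; what remains of the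
  damping is still at least \<open>\<delta> / 2\<close>.\<close>

lemma coercivity_by_Young:
  fixes a c \<mu> s x y :: real
  assumes "a > 0" "\<mu> > 0" "s > 0" "a \<le> s\<^sup>2"
  defines "\<delta> \<equiv> \<mu> / (2 + c\<^sup>2 / a)"
  shows "\<delta> / 2 * (x\<^sup>2 + y\<^sup>2) \<le> \<delta> * x\<^sup>2 + \<delta> * (c / s) * x * y + (\<mu> - \<delta>) * y\<^sup>2"
proof -
  have den: "2 + c\<^sup>2 / a \<ge> 2" using assms by simp
  have \<delta>: "\<delta> > 0" "\<delta> * (2 + c\<^sup>2 / a) = \<mu>"
    unfolding \<delta>_def using den \<open>\<mu> > 0\<close> by (auto intro!: divide_pos_pos)
  define t where "t = c / s"
  have "t\<^sup>2 \<le> c\<^sup>2 / a"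
    using assms by (auto simp: t_def power_divide intro!: divide_left_mono)
  then have "t\<^sup>2 * y\<^sup>2 \<le> c\<^sup>2 / a * y\<^sup>2"
    by (intro mult_right_mono) auto
  moreover have "0 \<le> (x + t * y)\<^sup>2" by simp
  ultimately have "0 \<le> \<delta> * (x\<^sup>2 + 2 * t * x * y + c\<^sup>2 / a * y\<^sup>2)"
    using \<delta> by (intro mult_nonneg_nonneg) (auto simp: power2_eq_square algebra_simps)
  also have "\<dots> = \<delta> * x\<^sup>2 + 2 * (\<delta> * t * x * y) + \<delta> * (c\<^sup>2 / a) * y\<^sup>2"
    by (simp add: algebra_simps)
  also have "\<delta> * (c\<^sup>2 / a) = \<mu> - 2 * \<delta>"
    using \<delta>(2) by (simp add: algebra_simps)
  finally have "0 \<le> \<delta> * x\<^sup>2 + 2 * (\<delta> * t * x * y) + (\<mu> - 2 * \<delta>) * y\<^sup>2" .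
  moreover have "0 \<le> (\<mu> - \<delta>) * y\<^sup>2"
  proof -
    have "\<delta> * 2 \<le> \<delta> * (2 + c\<^sup>2 / a)" using \<delta>(1) den by (intro mult_left_mono) auto
    with \<delta> show ?thesis by simp
  qed
  ultimately show ?thesis
    unfolding t_def[symmetric] by (simp add: field_simps)
qed

theorem lemma9:
  fixes \<gamma> \<mu> k \<rho> m :: real
  assumes "\<gamma> > 1" and "\<mu> > 0" and "k > 0"
    and "\<rho> > 0"
    and "deriv (pressure \<gamma>) \<rho> > m\<^sup>2 / \<rho>\<^sup>2"
  shows "\<exists>K :: real \<Rightarrow> real ^ 2 ^ 2.
    compensating_matrix_symbol (\<lambda>\<xi>. mat 1) (A_hat \<gamma> k \<rho> m) (\<lambda>\<xi>. B_star \<mu>) K \<and>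
    (\<forall>\<xi>. skew_symmetric (K \<xi>)) \<and>
    (\<exists>C>0. \<forall>\<xi>. op_norm (\<xi> *\<^sub>R K \<xi>) \<le> C \<and> op_norm (K \<xi>) \<le> C)"
proof -
  define a where "a = deriv (pressure \<gamma>) \<rho> - m\<^sup>2 / \<rho>\<^sup>2"
  define b where "b = (1 / 2) * k\<^sup>2"
  define c where "c = 2 * m / \<rho>"
  define s where "s \<xi> = sqrt (alpha \<gamma> k \<rho> m \<xi>)" for \<xi>
  define \<delta> where "\<delta> = \<mu> / (2 + c\<^sup>2 / a)"
  define K where "K \<xi> = (\<delta> / s \<xi>) *\<^sub>R rot90" for \<xi>
  have a: "a > 0" and b: "b > 0" using assms by (auto simp: a_def b_def)
  have \<delta>: "\<delta> > 0" using a assms by (auto simp: \<delta>_def intro!: divide_pos_pos add_pos_nonneg)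
  have alpha: "alpha \<gamma> k \<rho> m \<xi> = a + b * \<xi>\<^sup>2" for \<xi>
    by (simp add: alpha_def a_def b_def)
  have alpha_pos: "a + b * \<xi>\<^sup>2 > 0" for \<xi>
    using a b by (intro add_pos_nonneg) auto
  have s: "s \<xi> > 0" and s2: "(s \<xi>)\<^sup>2 = a + b * \<xi>\<^sup>2" for \<xi>
    using alpha_pos[of \<xi>] by (simp_all add: s_def alpha)
  have sa: "sqrt a \<le> s \<xi>" and sb: "sqrt b * \<bar>\<xi>\<bar> \<le> s \<xi>" for \<xi>
  proof -
    show "sqrt a \<le> s \<xi>" using b by (simp add: s_def alpha)
    have "sqrt b * \<bar>\<xi>\<bar> = sqrt (b * \<xi>\<^sup>2)" by (simp add: real_sqrt_mult)
    also have "\<dots> \<le> s \<xi>" using a by (simp add: s_def alpha)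
    finally show "sqrt b * \<bar>\<xi>\<bar> \<le> s \<xi>" .
  qed

  have "smooth K"
  proof -
    have "smooth (\<lambda>\<xi>. poly [:a, 0, b:] \<xi> powr (- 1 / 2))"
      using alpha_pos by (intro smooth_poly_powr)
        (simp add: power2_eq_square mult.commute mult.left_commute)
    moreover have "K \<xi> = (poly [:a, 0, b:] \<xi> powr (- 1 / 2)) *\<^sub>R (\<delta> *\<^sub>R rot90)" for \<xi>
    proof -
      have "poly [:a, 0, b:] \<xi> = (s \<xi>)\<^sup>2"
        unfolding s2 by (simp add: power2_eq_square)
      moreover have "(s \<xi>)\<^sup>2 powr (- 1 / 2) = 1 / s \<xi>"
        using s[of \<xi>] by (simp add: powr_minus_divide powr_half_sqrt)
      ultimately show ?thesis
        unfolding K_def by (simp only:) simp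
    qed
    ultimately show ?thesis
      using smooth_scaleR_const[of _ "\<delta> *\<^sub>R rot90"] by presburger
  qed

  moreover have "skew_symmetric (K \<xi>)" for \<xi>
    unfolding K_def by (rule skew_symmetric_scaleR_rot90)

  moreover have "quad_form_le ((\<delta> / 2) *\<^sub>R mat 1)
      (sym_part (K \<xi> ** A_hat \<gamma> k \<rho> m \<xi>) + B_star \<mu>)" for \<xi>
    unfolding quad_form_le_def
  proof
    fix v :: "real ^ 2"
    have "v \<bullet> (((\<delta> / 2) *\<^sub>R mat 1) *v v) = \<delta> / 2 * ((v $ 1)\<^sup>2 + (v $ 2)\<^sup>2)"
      by (simp flip: scaleR_matrix_vector_assoc add: inner_vec_def sum_2 power2_eq_square distrib_left mult.left_commute)
    also have "\<dots> \<le> \<delta> * (v $ 1)\<^sup>2 + \<delta> * (c / s \<xi>) * (v $ 1) * (v $ 2) + (\<mu> - \<delta>) * (v $ 2)\<^sup>2"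
      unfolding \<delta>_def using a b \<open>\<mu> > 0\<close> s[of \<xi>]
      by (intro coercivity_by_Young) (auto simp: s2)
    also have "\<dots> = v \<bullet> ((sym_part (K \<xi> ** A_hat \<gamma> k \<rho> m \<xi>) + B_star \<mu>) *v v)"
      using s[of \<xi>] quad_form_compensated[of v "\<delta> / s \<xi>" "s \<xi>" c \<mu>]
      by (simp add: K_def A_hat_def c_def s_def)
    finally show "v \<bullet> (((\<delta> / 2) *\<^sub>R mat 1) *v v)
      \<le> v \<bullet> ((sym_part (K \<xi> ** A_hat \<gamma> k \<rho> m \<xi>) + B_star \<mu>) *v v)" .
  qed
  then have "\<exists>\<theta>>0. \<forall>\<xi>. quad_form_le (\<theta> *\<^sub>R mat 1)
      (sym_part (K \<xi> ** A_hat \<gamma> k \<rho> m \<xi>) + B_star \<mu>)"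
    using \<delta> by (intro exI[of _ "\<delta> / 2"]) auto

  moreover have "\<exists>C>0. \<forall>\<xi>. op_norm (\<xi> *\<^sub>R K \<xi>) \<le> C \<and> op_norm (K \<xi>) \<le> C"
  proof (intro exI[of _ "\<delta> / sqrt a + \<delta> / sqrt b"] conjI allI)
    show "\<delta> / sqrt a + \<delta> / sqrt b > 0" using a b \<delta> by (intro add_pos_pos) auto
    fix \<xi>
    have "op_norm (\<xi> *\<^sub>R K \<xi>) \<le> \<bar>\<xi> * (\<delta> / s \<xi>)\<bar>"
      using op_norm_scaleR_rot90_le[of "\<xi> * (\<delta> / s \<xi>)"] by (simp add: K_def)
    also have "\<dots> = \<delta> * (\<bar>\<xi>\<bar> / s \<xi>)" using \<delta> s[of \<xi>] by (simp add: abs_mult)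
    also have "\<dots> \<le> \<delta> * (1 / sqrt b)"
      using \<delta> s[of \<xi>] b sb[of \<xi>] by (intro mult_left_mono) (simp_all add: field_simps)
    finally show "op_norm (\<xi> *\<^sub>R K \<xi>) \<le> \<delta> / sqrt a + \<delta> / sqrt b"
      using a \<delta> by (simp add: add_increasing)
    have "op_norm (K \<xi>) \<le> \<bar>\<delta> / s \<xi>\<bar>"
      using op_norm_scaleR_rot90_le[of "\<delta> / s \<xi>"] by (simp add: K_def)
    also have "\<dots> \<le> \<delta> / sqrt a"
      using \<delta> s[of \<xi>] a sa[of \<xi>] by (simp add: frac_le)
    finally show "op_norm (K \<xi>) \<le> \<delta> / sqrt a + \<delta> / sqrt b"
      using b \<delta> by (simp add: add_increasing2)
  qed

  ultimately show ?thesis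
    unfolding compensating_matrix_symbol_def
    by (intro exI[of _ K]) simp
qed

end
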